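(* Let $f:\mathbb{C}^n\to\mathbb{R}$ be real-analytic (as a function on $\mathbb{R}^{2n}$). Then at every point of $\mathbb{C}^n$ the matrix $\mathcal{H}^{\mathbb{C}}_{\mathbf{c}\mathbf{c}}$ is Hermitian and satisfies $$\mathcal{H}^{\mathbb{C}}_{\mathbf{c}\mathbf{c}}=S\,\overline{\mathcal{H}^{\mathbb{C}}_{\mathbf{c}\mathbf{c}}}\,S;$$ equivalently to this last identity, $\mathcal{H}^{\mathbb{C}}_{\mathbf{c}\mathbf{c}}$ maps $\mathcal{C}$ into $\mathcal{C}$. Moreover $\mathcal{H}^{\mathbb{R}}_{\mathbf{c}\mathbf{c}}=S\,\mathcal{H}^{\mathbb{C}}_{\mathbf{c}\mathbf{c}}$, and $\mathcal{H}^{\mathbb{R}}_{\mathbf{c}\mathbf{c}}$ is symmetric, i.e. $\mathcal{H}^{\mathbb{R}}_{\mathbf{c}\mathbf{c}}=\left(\mathcal{H}^{\mathbb{R}}_{\mathbf{c}\mathbf{c}}\right)^T$.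
   Context: Here $j=\sqrt{-1}$, a bar is entrywise complex conjugation, and ${}^H$ is conjugate transpose. Write $\mathbf{z}=\mathbf{x}+j\mathbf{y}\in\mathbb{C}^n$ and $\mathbf{c}=(\mathbf{z}^T,\bar{\mathbf{z}}^T)^T$. Let $\mathcal{C}=\left\{\begin{pmatrix}\mathbf{w}\\ \bar{\mathbf{w}}\end{pmatrix}:\mathbf{w}\in\mathbb{C}^n\right\}\subset\mathbb{C}^{2n}$ and let $S=\begin{pmatrix}0&I\\ I&0\end{pmatrix}$ be the $2n\times 2n$ block swap matrix, $I$ the $n\times n$ identity. Define the row operators $\frac{\partial}{\partial\mathbf{z}}=\frac12\left(\frac{\partial}{\partial\mathbf{x}}-j\frac{\partial}{\partial\mathbf{y}}\right)$, $\frac{\partial}{\partial\bar{\mathbf{z}}}=\frac12\left(\frac{\partial}{\partial\mathbf{x}}+j\frac{\partial}{\partial\mathbf{y}}\right)$ and $\frac{\partial}{\partial\mathbf{c}}=\left(\frac{\partial}{\partial\mathbf{z}},\frac{\partial}{\partial\bar{\mathbf{z}}}\right)$. Applied to a column-vector-valued function $F$, such an operator gives the matrix whose $(k,l)$ entry is the $l$-th component operator applied to $F_k$. Define $$\mathcal{H}^{\mathbb{C}}_{\mathbf{c}\mathbf{c}}=\frac{\partial}{\partial\mathbf{c}}\left(\frac{\partial f}{\partial\mathbf{c}}\right)^H,\qquad \mathcal{H}^{\mathbb{R}}_{\mathbf{c}\mathbf{c}}=\frac{\partial}{\partial\mathbf{c}}\left(\frac{\partial f}{\partial\mathbf{c}}\right)^T.$$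 *)

theory Defs
  imports "HOL-Analysis.Analysis"
begin

section \<open>Real-analytic functions\<close>

text \<open>
  Local expansion into a convergent real power series in the coordinates \<^term>\<open>h \<bullet> b\<close>,
  \<^term>\<open>b \<in> Basis\<close>. The multi-indices are the extensional functions from \<^term>\<open>Basis\<close> to the
  naturals. On \<^typ>\<open>complex^'n\<close> the coordinates are the real and imaginary parts of the entries
  (see \<open>Basis_complex_vec\<close> and \<open>inner_axis_complex\<close> below), so the notion is real-analyticity
  on the real space of dimension $2n$.
\<close>

definition real_analytic :: "('a::euclidean_space \<Rightarrow> real) \<Rightarrow> bool" where
  "real_analytic g \<longleftrightarrow>
     (\<forall>p. \<exists>r>0. \<exists>a :: ('a \<Rightarrow> nat) \<Rightarrow> real. \<forall>h\<in>ball 0 r.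
        ((\<lambda>\<alpha>. a \<alpha> * (\<Prod>b\<in>Basis. (h \<bullet> b) ^ \<alpha> b)) has_sum g (p + h)) (Basis \<rightarrow>\<^sub>E UNIV))"

lemma Basis_complex_vec:
  "(Basis :: (complex^'n) set) = range (\<lambda>k. axis k 1) \<union> range (\<lambda>k. axis k \<i>)"
  by (auto simp: Basis_vec_def Basis_complex_def)

lemma inner_axis_complex:
  fixes z :: "complex^'n"
  shows "z \<bullet> axis k 1 = Re (z $ k)" "z \<bullet> axis k \<i> = Im (z $ k)"
  by (simp_all add: inner_axis)


section \<open>Wirtinger derivatives\<close>

definition partial_x :: "'n \<Rightarrow> (complex^('n::finite) \<Rightarrow> complex) \<Rightarrow> complex^'n \<Rightarrow> complex" where
  "partial_x k g z = vector_derivative (\<lambda>t. g (z + t *\<^sub>R axis k 1)) (at 0)"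

definition partial_y :: "'n \<Rightarrow> (complex^('n::finite) \<Rightarrow> complex) \<Rightarrow> complex^'n \<Rightarrow> complex" where
  "partial_y k g z = vector_derivative (\<lambda>t. g (z + t *\<^sub>R axis k \<i>)) (at 0)"

definition partial_z :: "'n \<Rightarrow> (complex^('n::finite) \<Rightarrow> complex) \<Rightarrow> complex^'n \<Rightarrow> complex" where
  "partial_z k g z = (1/2) * (partial_x k g z - \<i> * partial_y k g z)"

definition partial_zbar :: "'n \<Rightarrow> (complex^('n::finite) \<Rightarrow> complex) \<Rightarrow> complex^'n \<Rightarrow> complex" where
  "partial_zbar k g z = (1/2) * (partial_x k g z + \<i> * partial_y k g z)"

text \<open>
  Vectors and matrices of size $2n$ are indexed by \<^typ>\<open>'n + 'n\<close>: \<^const>\<open>Inl\<close> is the first block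
  (the $z$ part of $c$), \<^const>\<open>Inr\<close> the second (the $\bar z$ part).
\<close>

definition partial_c :: "'n + 'n \<Rightarrow> (complex^('n::finite) \<Rightarrow> complex) \<Rightarrow> complex^'n \<Rightarrow> complex" where
  "partial_c l g z = (case l of Inl k \<Rightarrow> partial_z k g z | Inr k \<Rightarrow> partial_zbar k g z)"

definition deriv_c :: "(complex^('n::finite) \<Rightarrow> complex^'m) \<Rightarrow> complex^'n \<Rightarrow> complex^('n + 'n)^'m" where
  "deriv_c F z = (\<chi> k l. partial_c l (\<lambda>w. F w $ k) z)"


section \<open>Matrices\<close>

definition conj_mat :: "complex^'n^'m \<Rightarrow> complex^'n^'m" where
  "conj_mat A = map_matrix cnj A"

definition conj_transpose :: "complex^'n^'m \<Rightarrow> complex^'m^'n" where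
  "conj_transpose A = conj_mat (transpose A)"

definition hermitian :: "complex^'n^'n \<Rightarrow> bool" where
  "hermitian A \<longleftrightarrow> conj_transpose A = A"

definition block_mat ::
  "'a^'n^'m \<Rightarrow> 'a^'p^'m \<Rightarrow> 'a^'n^'q \<Rightarrow> 'a^'p^'q \<Rightarrow> 'a^('n + 'p)^('m + 'q)" where
  "block_mat A B C D = (\<chi> k l.
     case k of
       Inl i \<Rightarrow> (case l of Inl j \<Rightarrow> A $ i $ j | Inr j \<Rightarrow> B $ i $ j)
     | Inr i \<Rightarrow> (case l of Inl j \<Rightarrow> C $ i $ j | Inr j \<Rightarrow> D $ i $ j))"

definition swap_mat :: "complex^('n::finite + 'n)^('n + 'n)" where
  "swap_mat = block_mat 0 (mat 1) (mat 1) 0"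

definition conj_stack :: "complex^('n::finite) \<Rightarrow> complex^('n + 'n)" where
  "conj_stack w = (\<chi> k. case k of Inl i \<Rightarrow> w $ i | Inr i \<Rightarrow> cnj (w $ i))"

definition conj_space :: "(complex^('n::finite + 'n)) set" where
  "conj_space = {conj_stack w | w. True}"


section \<open>The gradient and the two Hessians\<close>

text \<open>
  \<open>grad_c f z\<close> is a row, i.e. a matrix with one row; \<open>column 1\<close> turns a matrix with
  one column into the corresponding vector.
\<close>

definition grad_c :: "(complex^('n::finite) \<Rightarrow> real) \<Rightarrow> complex^'n \<Rightarrow> complex^('n + 'n)^1" where
  "grad_c f z = deriv_c (\<lambda>w. vec (complex_of_real (f w)) :: complex^1) z"

definition hessian_C :: "(complex^('n::finite) \<Rightarrow> real) \<Rightarrow> complex^'n \<Rightarrow> complex^('n + 'n)^('n + 'n)" where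
  "hessian_C f z = deriv_c (\<lambda>w. column 1 (conj_transpose (grad_c f w))) z"

definition hessian_R :: "(complex^('n::finite) \<Rightarrow> real) \<Rightarrow> complex^'n \<Rightarrow> complex^('n + 'n)^('n + 'n)" where
  "hessian_R f z = deriv_c (\<lambda>w. column 1 (transpose (grad_c f w))) z"

end

(*
  On the plane through p spanned by two coordinate directions b and c, the power series of f at p
  becomes a double series with coefficients A i j. Differentiating it at 0, once in each variable,
  gives A 1 1 in either order, so the mixed second derivatives exist and commute. Hence H_R is
  symmetric. Since f is real, conjugating a Wirtinger derivative exchanges z and its conjugate; entrywise this says
  that H_C is H_R with swapped row index and that conj H_R is H_R with both indices swapped. The
  remaining identities are index manipulations.
*)
theory Submission
  imports Defs
begin

section \<open>Iterated derivatives of real-analytic functions\<close>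

text \<open>\<open>deriv\<close> has a value even where the function is not differentiable, so
  existence is proved separately, in \<open>real_analytic_has_dir_deriv\<close> and
  \<open>has_dir_deriv_dir_deriv\<close>.\<close>

definition dir_deriv :: "'a::real_vector \<Rightarrow> ('a \<Rightarrow> real) \<Rightarrow> 'a \<Rightarrow> real" where
  "dir_deriv b g p = deriv (\<lambda>t. g (p + t *\<^sub>R b)) 0"

section \<open>Termwise differentiation of power series in one and two variables\<close>

lemma powser_sums_has_field_derivative:
  fixes c :: "nat \<Rightarrow> real"
  assumes F: "\<And>t. \<bar>t\<bar> < r \<Longrightarrow> (\<lambda>n. c n * t ^ n) sums F t"
    and s: "\<bar>s\<bar> < r"
  shows "(F has_real_derivative (\<Sum>n. diffs c n * s ^ n)) (at s)"
proof (rule has_field_derivative_transform_within_open)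
  show "((\<lambda>t. \<Sum>n. c n * t ^ n) has_real_derivative (\<Sum>n. diffs c n * s ^ n)) (at s)"
    by (rule termdiffs_strong'[where K = r]) (use F s in \<open>auto intro: sums_summable\<close>)
  show "open (ball 0 r)" "s \<in> ball 0 r"
    using s by auto
  show "(\<Sum>n. c n * t ^ n) = F t" if "t \<in> ball 0 r" for t
    using F[of t] that by (simp add: sums_iff)
qed

lemma powser_sums_has_field_derivative_0:
  fixes c :: "nat \<Rightarrow> real"
  assumes "\<And>t. \<bar>t\<bar> < r \<Longrightarrow> (\<lambda>n. c n * t ^ n) sums F t" and "r > 0"
  shows "(F has_real_derivative c 1) (at 0)"
  using powser_sums_has_field_derivative[OF assms(1), of r 0] assms(2)
  by (simp add: diffs_def)

text \<open>Summing over \<open>i\<close> first turns \<open>F s\<close> into a power series in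
  \<open>t\<close> with coefficients \<open>g s j\<close>. Its derivative at 0 is
  \<open>g s 1\<close>, again a power series, now in \<open>s\<close>, whose linear coefficient is
  \<open>A 1 1\<close>.\<close>

lemma double_powser_mixed_derivative:
  fixes A :: "nat \<Rightarrow> nat \<Rightarrow> real"
  assumes F: "\<And>s t. \<bar>s\<bar> < r \<Longrightarrow> \<bar>t\<bar> < r \<Longrightarrow>
      ((\<lambda>(i, j). A i j * s ^ i * t ^ j) has_sum F s t) UNIV"
    and r: "r > 0"
  shows "((\<lambda>s. deriv (F s) 0) has_real_derivative A 1 1) (at 0)"
proof -
  define g where "g s j = (\<Sum>\<^sub>\<infinity>i. A i j * s ^ i)" for s j
  have swapped: "((\<lambda>(j, i). A i j * s ^ i * t ^ j) has_sum F s t) (UNIV \<times> UNIV)"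
    if "\<bar>s\<bar> < r" "\<bar>t\<bar> < r" for s t
    using F[OF that] has_sum_swap[of "\<lambda>(i, j). A i j * s ^ i * t ^ j" UNIV UNIV]
    by simp
  have g: "((\<lambda>i. A i j * s ^ i) has_sum g s j) UNIV" if s: "\<bar>s\<bar> < r" for s j
  proof -
    \<comment> \<open>Any nonzero \<open>t\<close> in the interval would do in place of
      \<open>r / 2\<close>: the factor \<open>t ^ j\<close> can then be cancelled from the
      slice.\<close>
    have "(\<lambda>i. A i j * s ^ i * (r / 2) ^ j) summable_on UNIV"
      using summable_on_SigmaD1[OF has_sum_imp_summable[OF swapped[of s "r / 2"]], of j] s r
      by auto
    then have "(\<lambda>i. A i j * s ^ i) summable_on UNIV"
      using r by (subst (asm) summable_on_cmult_left') auto
    then show ?thesis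
      unfolding g_def by (rule has_sum_infsum)
  qed
  have "(\<lambda>j. g s j * t ^ j) sums F s t" if "\<bar>s\<bar> < r" "\<bar>t\<bar> < r" for s t
    by (intro has_sum_imp_sums has_sum_SigmaD[OF swapped[OF that]])
       (use g[OF that(1)] in \<open>auto intro: has_sum_cmult_left\<close>)
  then have dF: "deriv (F s) 0 = g s 1" if "\<bar>s\<bar> < r" for s
    using that r by (intro DERIV_imp_deriv powser_sums_has_field_derivative_0[where r = r]) auto
  have "((\<lambda>s. g s 1) has_real_derivative A 1 1) (at 0)"
    by (rule powser_sums_has_field_derivative_0[OF has_sum_imp_sums[OF g] r])
  then show ?thesis
    by (rule has_field_derivative_transform_within_open[where S = "ball 0 r"])
       (use r dF in auto)
qed

section \<open>Restriction to coordinate lines and planes\<close>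

lemma real_analytic_on_line:
  fixes f :: "'a::euclidean_space \<Rightarrow> real"
  assumes "real_analytic f" and b: "b \<in> Basis"
  obtains r c where "r > 0"
    "\<And>s. \<bar>s\<bar> < r \<Longrightarrow> (\<lambda>i. c i * s ^ i) sums f (p + s *\<^sub>R b)"
proof -
  obtain r a where r: "r > 0" and a: "\<And>h. h \<in> ball 0 r \<Longrightarrow>
      ((\<lambda>\<alpha>. a \<alpha> * (\<Prod>d\<in>Basis. (h \<bullet> d) ^ \<alpha> d)) has_sum f (p + h)) (Basis \<rightarrow>\<^sub>E UNIV)"
    using assms(1) unfolding real_analytic_def by metis
  \<comment> \<open>The multi-indices supported on \<open>b\<close>, restricted to
    \<open>Basis\<close> so that they are extensional. On the line only their monomials survive: for
    any other multi-index some factor is 0 to a positive power.\<close>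
  define e :: "nat \<Rightarrow> 'a \<Rightarrow> nat" where "e i = (\<lambda>d\<in>Basis. if d = b then i else 0)" for i
  have inj: "inj e"
  proof (rule injI)
    fix i j assume "e i = e j"
    then have "e i b = e j b" by simp
    then show "i = j" using b by (simp add: e_def)
  qed
  have ran: "\<alpha> \<in> range e"
    if "\<alpha> \<in> Basis \<rightarrow>\<^sub>E UNIV" and "\<And>d. d \<in> Basis \<Longrightarrow> d \<noteq> b \<Longrightarrow> \<alpha> d = 0" for \<alpha>
    by (rule range_eqI[of _ _ "\<alpha> b"])
       (use that in \<open>auto simp: e_def fun_eq_iff PiE_def extensional_def\<close>)
  have "(\<lambda>i. a (e i) * s ^ i) sums f (p + s *\<^sub>R b)" if s: "\<bar>s\<bar> < r" for s
  proof (rule has_sum_imp_sums)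
    define h where "h = s *\<^sub>R b"
    have hd: "h \<bullet> d = (if d = b then s else 0)" if "d \<in> Basis" for d
      using that b by (auto simp: h_def inner_Basis)
    have "h \<in> ball 0 r"
      using s b by (simp add: h_def)
    from a[OF this]
    have "((\<lambda>\<alpha>. a \<alpha> * (\<Prod>d\<in>Basis. (h \<bullet> d) ^ \<alpha> d)) has_sum f (p + h)) (range e)"
    proof (subst (asm) has_sum_cong_neutral[where T = "range e"])
      fix \<alpha> assume "\<alpha> \<in> (Basis \<rightarrow>\<^sub>E UNIV) - range e"
      then obtain d where "d \<in> Basis" "d \<noteq> b" "\<alpha> d \<noteq> 0"
        using ran by blast
      then show "a \<alpha> * (\<Prod>d\<in>Basis. (h \<bullet> d) ^ \<alpha> d) = 0"
        by (auto simp: hd power_0_left intro!: bexI[of _ d])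
    qed (auto simp: e_def)
    then have "((\<lambda>i. a (e i) * (\<Prod>d\<in>Basis. (h \<bullet> d) ^ e i d)) has_sum f (p + h)) UNIV"
      by (simp add: has_sum_reindex[OF inj] o_def)
    also have "(\<lambda>i. \<Prod>d\<in>Basis. (h \<bullet> d) ^ e i d) = (\<lambda>i. \<Prod>d\<in>Basis. if d = b then s ^ i else 1)"
      by (intro ext prod.cong) (auto simp: hd e_def)
    finally show "((\<lambda>i. a (e i) * s ^ i) has_sum f (p + s *\<^sub>R b)) UNIV"
      using b by (simp add: h_def)
  qed
  with r show ?thesis
    by (rule that)
qed

lemma real_analytic_on_plane:
  fixes f :: "'a::euclidean_space \<Rightarrow> real"
  assumes "real_analytic f" and b: "b \<in> Basis" and c: "c \<in> Basis" and bc: "b \<noteq> c"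
  obtains r A where "r > 0"
    "\<And>s t. \<bar>s\<bar> < r \<Longrightarrow> \<bar>t\<bar> < r \<Longrightarrow>
      ((\<lambda>(i, j). A i j * s ^ i * t ^ j) has_sum f (p + s *\<^sub>R b + t *\<^sub>R c)) UNIV"
proof -
  obtain r a where r: "r > 0" and a: "\<And>h. h \<in> ball 0 r \<Longrightarrow>
      ((\<lambda>\<alpha>. a \<alpha> * (\<Prod>d\<in>Basis. (h \<bullet> d) ^ \<alpha> d)) has_sum f (p + h)) (Basis \<rightarrow>\<^sub>E UNIV)"
    using assms(1) unfolding real_analytic_def by metis
  define e :: "nat \<times> nat \<Rightarrow> 'a \<Rightarrow> nat" where
    "e = (\<lambda>(i, j). \<lambda>d\<in>Basis. if d = b then i else if d = c then j else 0)"
  have inj: "inj e"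
  proof (rule injI)
    fix x y assume "e x = e y"
    then have "e x b = e y b" "e x c = e y c" by simp_all
    then show "x = y" using b c bc by (auto simp: e_def split: prod.splits)
  qed
  have ran: "\<alpha> \<in> range e"
    if "\<alpha> \<in> Basis \<rightarrow>\<^sub>E UNIV" and "\<And>d. d \<in> Basis \<Longrightarrow> d \<noteq> b \<Longrightarrow> d \<noteq> c \<Longrightarrow> \<alpha> d = 0" for \<alpha>
    by (rule range_eqI[of _ _ "(\<alpha> b, \<alpha> c)"])
       (use that in \<open>auto simp: e_def fun_eq_iff PiE_def extensional_def\<close>)
  have "((\<lambda>(i, j). a (e (i, j)) * s ^ i * t ^ j) has_sum f (p + s *\<^sub>R b + t *\<^sub>R c)) UNIV"
    \<comment> \<open>Halving the radius puts the whole square inside the ball, by the triangle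
      inequality.\<close>
    if s: "\<bar>s\<bar> < r / 2" and t: "\<bar>t\<bar> < r / 2" for s t
  proof -
    define h where "h = s *\<^sub>R b + t *\<^sub>R c"
    have hd: "h \<bullet> d = (if d = b then s else if d = c then t else 0)" if "d \<in> Basis" for d
      using that b c bc by (auto simp: h_def inner_Basis inner_add_left)
    have "norm h \<le> \<bar>s\<bar> + \<bar>t\<bar>"
      unfolding h_def by (rule norm_triangle_le) (use b c in simp)
    then have "h \<in> ball 0 r"
      using s t by simp
    from a[OF this]
    have "((\<lambda>\<alpha>. a \<alpha> * (\<Prod>d\<in>Basis. (h \<bullet> d) ^ \<alpha> d)) has_sum f (p + h)) (range e)"
    proof (subst (asm) has_sum_cong_neutral[where T = "range e"])
      fix \<alpha> assume "\<alpha> \<in> (Basis \<rightarrow>\<^sub>E UNIV) - range e"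
      then obtain d where "d \<in> Basis" "d \<noteq> b" "d \<noteq> c" "\<alpha> d \<noteq> 0"
        using ran by blast
      then show "a \<alpha> * (\<Prod>d\<in>Basis. (h \<bullet> d) ^ \<alpha> d) = 0"
        by (auto simp: hd power_0_left intro!: bexI[of _ d])
    qed (auto simp: e_def)
    then have "((\<lambda>x. a (e x) * (\<Prod>d\<in>Basis. (h \<bullet> d) ^ e x d)) has_sum f (p + h)) UNIV"
      by (simp add: has_sum_reindex[OF inj] o_def)
    moreover have "(\<Prod>d\<in>Basis. (h \<bullet> d) ^ e (i, j) d) = s ^ i * t ^ j" for i j
    proof -
      have "(\<Prod>d\<in>Basis. (h \<bullet> d) ^ e (i, j) d)
          = (\<Prod>d\<in>Basis. (if d = b then s ^ i else 1) * (if d = c then t ^ j else 1))"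
        using bc by (intro prod.cong) (auto simp: hd e_def)
      then show ?thesis
        using b c by (simp add: prod.distrib)
    qed
    then have "(\<lambda>x. a (e x) * (\<Prod>d\<in>Basis. (h \<bullet> d) ^ e x d))
        = (\<lambda>(i, j). a (e (i, j)) * s ^ i * t ^ j)"
      by (auto simp: fun_eq_iff)
    ultimately show ?thesis
      by (simp add: h_def add.assoc)
  qed
  with r show ?thesis
    by (intro that[of "r / 2" "\<lambda>i j. a (e (i, j))"]) auto
qed

section \<open>Existence and symmetry of directional derivatives\<close>

lemma real_analytic_has_dir_deriv:
  fixes f :: "'a::euclidean_space \<Rightarrow> real"
  assumes "real_analytic f" and "b \<in> Basis"
  shows "((\<lambda>t. f (p + t *\<^sub>R b)) has_real_derivative dir_deriv b f p) (at 0)"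
proof -
  obtain r c where "r > 0"
    "\<And>s. \<bar>s\<bar> < r \<Longrightarrow> (\<lambda>i. c i * s ^ i) sums f (p + s *\<^sub>R b)"
    using real_analytic_on_line[OF assms, of p] by blast
  then have "((\<lambda>t. f (p + t *\<^sub>R b)) has_real_derivative c 1) (at 0)"
    by (intro powser_sums_has_field_derivative_0)
  then show ?thesis
    unfolding dir_deriv_def by (simp add: DERIV_imp_deriv)
qed

text \<open>The common value \<open>L\<close> yields existence of both iterated derivatives and
  their equality at once. For \<open>b = c\<close> the plane degenerates, and a series on the line
  is differentiated twice instead.\<close>

lemma real_analytic_mixed_dir_deriv:
  fixes f :: "'a::euclidean_space \<Rightarrow> real"
  assumes f: "real_analytic f" and b: "b \<in> Basis" and c: "c \<in> Basis"
  shows "\<exists>L. ((\<lambda>s. dir_deriv c f (p + s *\<^sub>R b)) has_real_derivative L) (at 0) \<and>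
             ((\<lambda>s. dir_deriv b f (p + s *\<^sub>R c)) has_real_derivative L) (at 0)"
proof (cases "b = c")
  case True
  obtain r a where r: "r > 0"
    and a: "\<And>s. \<bar>s\<bar> < r \<Longrightarrow> (\<lambda>i. a i * s ^ i) sums f (p + s *\<^sub>R b)"
    using real_analytic_on_line[OF f b, of p] by blast
  define D where "D s = (\<Sum>n. diffs a n * s ^ n)" for s
  \<comment> \<open>A second differentiation needs the first derivative near \<open>p\<close>, not
    only at \<open>p\<close>; shifting the parameter moves the derivative at \<open>s\<close> to
    0.\<close>
  have deriv: "dir_deriv b f (p + s *\<^sub>R b) = D s" if "\<bar>s\<bar> < r" for s
  proof -
    have "((\<lambda>t. f (p + t *\<^sub>R b)) has_real_derivative D s) (at s)"
      unfolding D_def using powser_sums_has_field_derivative[OF a that] by simp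
    then have "((\<lambda>t. f (p + (t + s) *\<^sub>R b)) has_real_derivative D s) (at 0)"
      using DERIV_shift[of "\<lambda>t. f (p + t *\<^sub>R b)" "D s" 0 s] by simp
    then show ?thesis
      unfolding dir_deriv_def by (intro DERIV_imp_deriv) (simp add: scaleR_left_distrib ac_simps)
  qed
  have "summable (\<lambda>n. diffs a n * s ^ n)" if "\<bar>s\<bar> < r" for s
    by (rule termdiff_converges[where K = r]) (use a that in \<open>auto intro: sums_summable\<close>)
  then have "(D has_real_derivative diffs a 1) (at 0)"
    unfolding D_def by (intro powser_sums_has_field_derivative_0[OF summable_sums r])
  then have "((\<lambda>s. dir_deriv b f (p + s *\<^sub>R b)) has_real_derivative diffs a 1) (at 0)"
    by (rule has_field_derivative_transform_within_open[where S = "ball 0 r"])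
       (use r deriv in auto)
  with True show ?thesis
    by auto
next
  case False
  obtain r A where r: "r > 0" and A: "\<And>s t. \<bar>s\<bar> < r \<Longrightarrow> \<bar>t\<bar> < r \<Longrightarrow>
      ((\<lambda>(i, j). A i j * s ^ i * t ^ j) has_sum f (p + s *\<^sub>R b + t *\<^sub>R c)) UNIV"
    using real_analytic_on_plane[OF f b c False, of p] by blast
  \<comment> \<open>The same coefficients with the variables exchanged, so the other order of
    differentiation also gives \<open>A 1 1\<close>.\<close>
  have A': "((\<lambda>(j, i). A i j * t ^ j * s ^ i) has_sum f (p + t *\<^sub>R c + s *\<^sub>R b)) UNIV"
    if "\<bar>t\<bar> < r" "\<bar>s\<bar> < r" for t s
    using A[OF that(2,1)] has_sum_swap[of "\<lambda>(i, j). A i j * s ^ i * t ^ j" UNIV UNIV]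
    by (simp add: ac_simps)
  show ?thesis
    unfolding dir_deriv_def
    using double_powser_mixed_derivative[OF A r]
      double_powser_mixed_derivative[where A = "\<lambda>j i. A i j", OF A' r]
    by blast
qed


section \<open>Second-order Wirtinger derivatives\<close>

text \<open>The index permutation of the block swap matrix, see \<open>swap_mat_nth\<close>; it
  pairs each coordinate of z with its conjugate.\<close>

definition flip :: "'n + 'n \<Rightarrow> 'n + 'n" where
  "flip = case_sum Inr Inl"

definition base :: "'n + 'n \<Rightarrow> 'n" where
  "base = case_sum id id"

text \<open>
  With \<open>\<epsilon> = conj_sign l\<close>, both Wirtinger operators have the form $(\partial_x + \epsilon\,\partial_y)/2$.
\<close>

definition conj_sign :: "'n + 'n \<Rightarrow> complex" where
  "conj_sign = case_sum (\<lambda>_. - \<i>) (\<lambda>_. \<i>)"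

lemma flip_simps [simp]: "flip (Inl i) = Inr i" "flip (Inr i) = Inl i"
  by (simp_all add: flip_def)

lemma flip_flip [simp]: "flip (flip k) = k"
  by (cases k) auto

lemma base_flip [simp]: "base (flip k) = base k"
  by (cases k) (auto simp: base_def)

lemma cnj_conj_sign [simp]: "cnj (conj_sign k) = conj_sign (flip k)"
  by (cases k) (auto simp: conj_sign_def)

lemma partial_c_eqI:
  assumes "((\<lambda>t. g (z + t *\<^sub>R axis (base l) 1)) has_vector_derivative u) (at 0)"
    and "((\<lambda>t. g (z + t *\<^sub>R axis (base l) \<i>)) has_vector_derivative v) (at 0)"
  shows "partial_c l g z = (u + conj_sign l * v) / 2"
  using vector_derivative_at[OF assms(1)] vector_derivative_at[OF assms(2)]
  by (cases l)
     (simp_all add: partial_c_def partial_z_def partial_zbar_def partial_x_def partial_y_def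
        base_def conj_sign_def field_simps)

lemma axis_complex_in_Basis: "axis i (1::complex) \<in> Basis" "axis i \<i> \<in> Basis"
  by (auto simp: Basis_complex_vec)

lemma partial_c_of_real:
  assumes "real_analytic f"
  shows "partial_c k (\<lambda>w. of_real (f w)) z
    = (of_real (dir_deriv (axis (base k) 1) f z)
       + conj_sign k * of_real (dir_deriv (axis (base k) \<i>) f z)) / 2"
  by (intro partial_c_eqI has_vector_derivative_of_real real_analytic_has_dir_deriv
        assms axis_complex_in_Basis)

lemma dir_deriv_commute:
  fixes f :: "'a::euclidean_space \<Rightarrow> real"
  assumes "real_analytic f" "b \<in> Basis" "c \<in> Basis"
  shows "dir_deriv b (dir_deriv c f) p = dir_deriv c (dir_deriv b f) p"
  using real_analytic_mixed_dir_deriv[OF assms, of p]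
  by (auto simp: dir_deriv_def[of b "dir_deriv c f"] dir_deriv_def[of c "dir_deriv b f"]
      dest!: DERIV_imp_deriv)

lemma has_dir_deriv_dir_deriv:
  fixes f :: "'a::euclidean_space \<Rightarrow> real"
  assumes "real_analytic f" "b \<in> Basis" "c \<in> Basis"
  shows "((\<lambda>s. dir_deriv c f (p + s *\<^sub>R b)) has_real_derivative
           dir_deriv b (dir_deriv c f) p) (at 0)"
  using real_analytic_mixed_dir_deriv[OF assms, of p]
  by (auto simp: dir_deriv_def[of b "dir_deriv c f"] DERIV_imp_deriv)

lemma partial_c_partial_c_of_real:
  fixes f :: "complex^'n \<Rightarrow> real" and z :: "complex^'n"
  assumes f: "real_analytic f"
  defines "D \<equiv> \<lambda>b c. complex_of_real (dir_deriv b (dir_deriv c f) z)"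
  shows "partial_c l (partial_c k (\<lambda>w. of_real (f w))) z
    = (D (axis (base l) 1) (axis (base k) 1)
       + conj_sign k * D (axis (base l) 1) (axis (base k) \<i>)
       + conj_sign l * D (axis (base l) \<i>) (axis (base k) 1)
       + conj_sign l * conj_sign k * D (axis (base l) \<i>) (axis (base k) \<i>)) / 4"
proof -
  have deriv: "((\<lambda>t. partial_c k (\<lambda>w. of_real (f w)) (z + t *\<^sub>R b)) has_vector_derivative
      (D b (axis (base k) 1) + conj_sign k * D b (axis (base k) \<i>)) / 2) (at 0)"
    if "b \<in> Basis" for b
    \<comment> \<open>The first-order formula holds at every point, so it may be substituted under
      the outer derivative.\<close>
    unfolding partial_c_of_real[OF f] D_def
    by (intro has_vector_derivative_divide has_vector_derivative_mult_right
          has_vector_derivative_add has_vector_derivative_of_real has_dir_deriv_dir_deriv f axis_complex_in_Basis that)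
  show ?thesis
    by (subst partial_c_eqI[OF deriv deriv, OF axis_complex_in_Basis])
       (simp add: algebra_simps add_divide_distrib)
qed

text \<open>Exchanging \<open>k\<close> and \<open>l\<close> in the four-term expansion only
  permutes the coefficients and reverses the order of each pair of real derivatives. The four
  instances cover the choices of real or imaginary direction.\<close>

lemma partial_c_partial_c_commute:
  fixes f :: "complex^'n \<Rightarrow> real"
  assumes "real_analytic f"
  shows "partial_c l (partial_c k (\<lambda>w. of_real (f w))) z
    = partial_c k (partial_c l (\<lambda>w. of_real (f w))) z"
  by (simp add: partial_c_partial_c_of_real[OF assms] algebra_simps
      dir_deriv_commute[OF assms axis_complex_in_Basis(1) axis_complex_in_Basis(1),
        of "base l" "base k"]
      dir_deriv_commute[OF assms axis_complex_in_Basis(1) axis_complex_in_Basis(2),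
        of "base l" "base k"]
      dir_deriv_commute[OF assms axis_complex_in_Basis(2) axis_complex_in_Basis(1),
        of "base l" "base k"]
      dir_deriv_commute[OF assms axis_complex_in_Basis(2) axis_complex_in_Basis(2),
        of "base l" "base k"])

text \<open>The directional derivatives are real, so conjugation affects only the factor
  \<open>conj_sign k\<close>.\<close>

lemma cnj_partial_c_of_real:
  assumes "real_analytic f"
  shows "cnj (partial_c k (\<lambda>w. of_real (f w)) z) = partial_c (flip k) (\<lambda>w. of_real (f w)) z"
  by (simp add: partial_c_of_real[OF assms])

lemma cnj_partial_c_partial_c_of_real:
  fixes f :: "complex^'n \<Rightarrow> real"
  assumes "real_analytic f"
  shows "cnj (partial_c l (partial_c k (\<lambda>w. of_real (f w))) z)
    = partial_c (flip l) (partial_c (flip k) (\<lambda>w. of_real (f w))) z"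
  by (simp add: partial_c_partial_c_of_real[OF assms])

section \<open>Entries of the two Hessians\<close>

lemma hessian_R_nth:
  "hessian_R f z $ k $ l = partial_c l (partial_c k (\<lambda>w. of_real (f w))) z"
  by (simp add: hessian_R_def deriv_c_def grad_c_def column_def transpose_def vec_def)

text \<open>The conjugated gradient is the gradient with flipped index at every point, hence also
  after differentiation.\<close>

lemma hessian_C_nth:
  assumes "real_analytic f"
  shows "hessian_C f z $ k $ l = hessian_R f z $ flip k $ l"
  by (simp add: hessian_R_nth hessian_C_def deriv_c_def grad_c_def column_def transpose_def vec_def
      conj_transpose_def conj_mat_def map_matrix_def cnj_partial_c_of_real[OF assms])

lemma hessian_R_commute:
  assumes "real_analytic f"
  shows "hessian_R f z $ k $ l = hessian_R f z $ l $ k"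
  unfolding hessian_R_nth by (rule partial_c_partial_c_commute[OF assms])

lemma cnj_hessian_R:
  assumes "real_analytic f"
  shows "cnj (hessian_R f z $ k $ l) = hessian_R f z $ flip k $ flip l"
  unfolding hessian_R_nth by (rule cnj_partial_c_partial_c_of_real[OF assms])


section \<open>The block swap matrix\<close>

lemma swap_mat_nth: "swap_mat $ k $ l = (if l = flip k then 1 else 0)"
  by (cases k; cases l) (auto simp: swap_mat_def block_mat_def mat_def)

lemma swap_mat_mult_nth: "(swap_mat ** M) $ k $ l = M $ flip k $ l"
  by (simp add: matrix_matrix_mult_def swap_mat_nth if_distrib[of "\<lambda>x. x * _"] cong: if_cong)

lemma mult_swap_mat_nth: "(M ** swap_mat) $ k $ l = M $ k $ flip l"
proof -
  \<comment> \<open>Solves for the summation index, so that the sum collapses to a single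
    term.\<close>
  have "l = flip i \<longleftrightarrow> i = flip l" for i
    by auto
  then show ?thesis
    by (simp add: matrix_matrix_mult_def swap_mat_nth if_distrib[of "\<lambda>x. _ * x"] cong: if_cong)
qed

section \<open>Block conjugation symmetry and invariance of \<open>conj_space\<close>\<close>

lemma swap_conj_swap_iff:
  "M = swap_mat ** conj_mat M ** swap_mat \<longleftrightarrow> (\<forall>k l. M $ k $ l = cnj (M $ flip k $ flip l))"
  by (simp add: vec_eq_iff swap_mat_mult_nth mult_swap_mat_nth conj_mat_def map_matrix_def)

lemma conj_space_iff: "v \<in> conj_space \<longleftrightarrow> (\<forall>k. v $ flip k = cnj (v $ k))"
proof
  assume "v \<in> conj_space"
  then show "\<forall>k. v $ flip k = cnj (v $ k)"
    by (auto simp: conj_space_def conj_stack_def flip_def split: sum.splits)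
next
  assume v: "\<forall>k. v $ flip k = cnj (v $ k)"
  have "v = conj_stack (\<chi> i. v $ Inl i)"
    using v[rule_format, of "Inl _"]
    by (auto simp: conj_stack_def vec_eq_iff split: sum.splits)
  then show "v \<in> conj_space"
    unfolding conj_space_def by blast
qed

text \<open>Forwards, the row sum is reindexed along \<open>flip\<close>. Backwards,
  \<open>M\<close> is tested on vectors supported on one conjugate pair of coordinates.\<close>

lemma swap_conj_swap_iff_preserves_conj_space:
  fixes M :: "complex^('n::finite + 'n)^('n + 'n)"
  shows "M = swap_mat ** conj_mat M ** swap_mat \<longleftrightarrow> (\<forall>v\<in>conj_space. M *v v \<in> conj_space)"
proof
  assume "M = swap_mat ** conj_mat M ** swap_mat"
  then have M: "M $ flip k $ flip l = cnj (M $ k $ l)" for k l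
    unfolding swap_conj_swap_iff by (metis flip_flip)
  have bij: "bij (flip :: 'n + 'n \<Rightarrow> _)"
    by (rule o_bij[of flip]) (auto simp: fun_eq_iff)
  show "\<forall>v\<in>conj_space. M *v v \<in> conj_space"
  proof (intro ballI)
    fix v :: "complex^('n + 'n)" assume "v \<in> conj_space"
    then have v: "v $ flip k = cnj (v $ k)" for k
      by (simp add: conj_space_iff)
    have "(M *v v) $ flip k = cnj ((M *v v) $ k)" for k
      unfolding matrix_vector_mult_def
      by (simp, subst sum.reindex_bij_betw[OF bij, symmetric]) (simp add: M v)
    then show "M *v v \<in> conj_space"
      by (simp add: conj_space_iff)
  qed
next
  assume M: "\<forall>v\<in>conj_space. M *v v \<in> conj_space"
  have test: "M $ flip k $ Inl j * a + M $ flip k $ Inr j * cnj a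
      = cnj (M $ k $ Inl j * a + M $ k $ Inr j * cnj a)" for k j a
  proof -
    define v :: "complex^('n + 'n)" where "v = axis (Inl j) a + axis (Inr j) (cnj a)"
    have "v \<in> conj_space"
      unfolding conj_space_iff
    proof
      fix k show "v $ flip k = cnj (v $ k)"
        by (cases k) (auto simp: v_def axis_def)
    qed
    then have "(M *v v) $ flip k = cnj ((M *v v) $ k)"
      using M by (simp add: conj_space_iff)
    moreover have "(M *v v) $ i = M $ i $ Inl j * a + M $ i $ Inr j * cnj a" for i
      by (simp add: v_def matrix_vector_mult_def axis_def distrib_left sum.distrib
          if_distrib[of "\<lambda>x. _ * x"] cong: if_cong)
    ultimately show ?thesis
      by simp
  qed
  \<comment> \<open>\<open>test\<close> has the form P a + Q cnj a = 0, with P and Q the two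
    differences to be shown zero. Taking a = 1 gives P + Q = 0 and a = \<i> gives P - Q = 0.\<close>
  have "M $ flip k $ Inl j = cnj (M $ k $ Inr j) \<and> M $ flip k $ Inr j = cnj (M $ k $ Inl j)" for k j
    using test[of k j 1] test[of k j \<i>] by (auto simp: complex_eq_iff)
  then have "M $ flip k $ flip l = cnj (M $ k $ l)" for k l
    by (cases l) auto
  then show "M = swap_mat ** conj_mat M ** swap_mat"
    unfolding swap_conj_swap_iff by (metis flip_flip)
qed

theorem mainTheorem2:
  fixes f :: "complex^'n \<Rightarrow> real"
  assumes "real_analytic f"
  shows "(\<forall>z.
        hermitian (hessian_C f z)
      \<and> hessian_C f z = swap_mat ** conj_mat (hessian_C f z) ** swap_mat
      \<and> (\<forall>v\<in>conj_space. hessian_C f z *v v \<in> conj_space)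
      \<and> hessian_R f z = swap_mat ** hessian_C f z
      \<and> hessian_R f z = transpose (hessian_R f z))
    \<and> (\<forall>M :: complex^('n + 'n)^('n + 'n).
        M = swap_mat ** conj_mat M ** swap_mat
        \<longleftrightarrow> (\<forall>v\<in>conj_space. M *v v \<in> conj_space))"
proof -
  note C = hessian_C_nth[OF assms] and R = cnj_hessian_R[OF assms]
  \<comment> \<open>With H = \<open>hessian_R f z\<close>: cnj (H (flip l) k) = H l (flip k) = H
    (flip k) l, by conjugation and then symmetry. The ends are the (k, l) entries of the conjugate
    transpose of \<open>hessian_C f z\<close> and of that matrix itself.\<close>
  have "hermitian (hessian_C f z)" for z
    by (simp add: hermitian_def conj_transpose_def conj_mat_def map_matrix_def transpose_def
        vec_eq_iff C R hessian_R_commute[OF assms, of z "flip _"])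
  moreover have "hessian_C f z = swap_mat ** conj_mat (hessian_C f z) ** swap_mat" for z
    by (simp add: swap_conj_swap_iff C R)
  moreover have "hessian_R f z = swap_mat ** hessian_C f z" for z
    by (simp add: vec_eq_iff swap_mat_mult_nth C)
  moreover have "hessian_R f z = transpose (hessian_R f z)" for z
    by (simp add: vec_eq_iff transpose_def hessian_R_commute[OF assms])
  ultimately show ?thesis
    using swap_conj_swap_iff_preserves_conj_space by blast
qed

end
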